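(* For every integer $k\ge 5$, $R(k,k+1)\ge NPO(k) > T_k$, where $T_k=\frac{k(k+1)}{2}$ is the $k$-th triangular number.
   Context: All graphs are finite, simple and undirected; $A(G)$ denotes the adjacency matrix of $G$. Eigenvalues are counted with multiplicity. For a positive integer $k$, $NPO(k)$ is the smallest integer $n$ such that the adjacency matrix of every graph with at least $n$ vertices has at least $k$ nonpositive eigenvalues. The Ramsey number $R(m,n)$ is the minimum number $N$ such that every graph on at least $N$ vertices has either an independent set of size $m$ or an induced subgraph isomorphic to the complete graph $K_n$. *)

theory Defs
  imports "Jordan_Normal_Form.Char_Poly"
begin

text \<open>A finite simple graph on the vertex set {0..<n}, given by an edge relation
  that is symmetric and irreflexive on the vertex set. Every finite simple graph
  is isomorphic to one of this form.\<close>
definition is_graph :: "nat \<Rightarrow> (nat \<Rightarrow> nat \<Rightarrow> bool) \<Rightarrow> bool" where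
  "is_graph n E \<longleftrightarrow> (\<forall>i<n. \<not> E i i) \<and> (\<forall>i<n. \<forall>j<n. E i j \<longleftrightarrow> E j i)"

definition adj_matrix :: "nat \<Rightarrow> (nat \<Rightarrow> nat \<Rightarrow> bool) \<Rightarrow> real mat" where
  "adj_matrix n E = mat n n (\<lambda>(i, j). if E i j then 1 else 0)"

definition num_nonpos_eigs :: "real mat \<Rightarrow> nat" where
  "num_nonpos_eigs A =
     (\<Sum>a \<in> {a. a \<le> 0 \<and> poly (char_poly A) a = 0}. order a (char_poly A))"

definition NPO :: "nat \<Rightarrow> nat" where
  "NPO k = (LEAST n. \<forall>m \<ge> n. \<forall>E. is_graph m E \<longrightarrow> num_nonpos_eigs (adj_matrix m E) \<ge> k)"

definition independent_set :: "nat \<Rightarrow> (nat \<Rightarrow> nat \<Rightarrow> bool) \<Rightarrow> nat set \<Rightarrow> bool" where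
  "independent_set n E S \<longleftrightarrow> S \<subseteq> {0..<n} \<and> (\<forall>i\<in>S. \<forall>j\<in>S. \<not> E i j)"

definition clique :: "nat \<Rightarrow> (nat \<Rightarrow> nat \<Rightarrow> bool) \<Rightarrow> nat set \<Rightarrow> bool" where
  "clique n E S \<longleftrightarrow> S \<subseteq> {0..<n} \<and> (\<forall>i\<in>S. \<forall>j\<in>S. i \<noteq> j \<longrightarrow> E i j)"

definition ramsey_num :: "nat \<Rightarrow> nat \<Rightarrow> nat" where
  "ramsey_num a b = (LEAST N. \<forall>m \<ge> N. \<forall>E. is_graph m E \<longrightarrow>
      (\<exists>S. independent_set m E S \<and> card S = a) \<or> (\<exists>S. clique m E S \<and> card S = b))"

end

theory Submission
  imports Defs "HOL-Library.Ramsey" "HOL-Computational_Algebra.Fundamental_Theorem_Algebra"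
begin

text \<open>
  For a real symmetric matrix, the number of nonpositive eigenvalues is at most \<open>c\<close> if the quadratic
  form is positive definite on the common kernel of \<open>c\<close> functionals, and at least \<open>n - c\<close> if it is
  nonpositive there. An independent set of size \<open>k\<close> makes the form vanish on the vectors supported
  on it, and a clique of size \<open>k + 1\<close> makes it negative on the vectors of coordinate sum 0 supported on
  it, which gives the upper bound.

  For the lower bound, take the singletons and pairs of points of \<open>{..<k}\<close> as vertices, join all
  singletons to each other, disjoint pairs to each other, and each singleton to the pairs containing it.
  With weights \<open>y\<close> on the pairs and \<open>z\<close> on the singletons, of total sums \<open>Y\<close> and \<open>Z\<close>, the form is
  \<open>Y\<^sup>2 + Z\<^sup>2 + \<bar>y\<bar>\<^sup>2 - (\<Sum>c<k. (t c)\<^sup>2)\<close> with \<open>t c = (\<Sum>p\<ni>c. y p) - z c\<close>. Where all \<open>t c\<close> equal a common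
  \<open>t\<close> (\<open>k - 1\<close> linear conditions) we have \<open>k t = 2 Y - Z\<close>, hence
  \<open>k t\<^sup>2 = (2 Y - Z)\<^sup>2 / k \<le> 5 (Y\<^sup>2 + Z\<^sup>2) / k\<close>, and the form is positive definite there for \<open>k \<ge> 5\<close>.
\<close>

subsection \<open>Diagonalization of real symmetric matrices\<close>

text \<open>Gaussian elimination, one equation per induction step. If the new equation has a nonzero
  coefficient \<open>a j p\<close>, it is solved for \<open>x p\<close> and substituted into the
  others, which removes one equation and one unknown; if all its coefficients vanish, it is
  dropped.\<close>

lemma homogeneous_system_nontrivial_solution:
  fixes a :: "'j \<Rightarrow> 'i \<Rightarrow> real"
  assumes "finite J" "finite I" "card J < card I"
  shows "\<exists>x. (\<exists>i\<in>I. x i \<noteq> 0) \<and> (\<forall>j\<in>J. (\<Sum>i\<in>I. a j i * x i) = 0)"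
  using assms
proof (induction J arbitrary: a I rule: finite_induct)
  case empty
  then show ?case
    by (intro exI[of _ "\<lambda>_. 1"]) (auto simp: card_gt_0_iff)
next
  case (insert j J)
  show ?case
  proof (cases "\<forall>i\<in>I. a j i = 0")
    case True
    then show ?thesis
      using insert.IH[of I a] insert.prems insert.hyps by auto
  next
    case False
    then obtain p where p: "p \<in> I" "a j p \<noteq> 0" by blast
    define I' where "I' = I - {p}"
    have I: "I = insert p I'" "p \<notin> I'" "finite I'"
      using p insert.prems by (auto simp: I'_def)
    have "card J < card I'"
      using insert.prems insert.hyps I by simp
    from insert.IH[OF I(3) this, of "\<lambda>l i. a l i - a l p * a j i / a j p"] obtain x where
      x: "\<exists>i\<in>I'. x i \<noteq> 0" "\<forall>l\<in>J. (\<Sum>i\<in>I'. (a l i - a l p * a j i / a j p) * x i) = 0" by blast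
    define y where "y = x(p := - (\<Sum>i\<in>I'. a j i * x i) / a j p)"
    have sum_y: "(\<Sum>i\<in>I. a l i * y i) = a l p * y p + (\<Sum>i\<in>I'. a l i * x i)" for l
      using I by (auto simp: y_def intro!: sum.cong)
    have "(\<Sum>i\<in>I. a l i * y i) = 0" if "l \<in> J" for l
    proof -
      have "(\<Sum>i\<in>I'. (a l i - a l p * a j i / a j p) * x i)
          = (\<Sum>i\<in>I'. a l i * x i) - a l p * (\<Sum>i\<in>I'. a j i * x i) / a j p"
        by (simp add: left_diff_distrib sum_subtractf sum_distrib_left sum_divide_distrib mult.assoc)
      then show ?thesis
        using x(2) that unfolding sum_y by (simp add: y_def)
    qed
    moreover have "(\<Sum>i\<in>I. a j i * y i) = 0"
      unfolding sum_y using p by (simp add: y_def)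
    moreover have "\<exists>i\<in>I. y i \<noteq> 0"
      using x(1) I by (auto simp: y_def)
    ultimately show ?thesis by blast
  qed
qed

text \<open>The characteristic polynomial has a complex root \<open>z\<close> with a complex
  eigenvector \<open>w\<close>. By symmetry of \<open>A\<close>, the Hermitian form of
  \<open>A\<close> at \<open>w\<close>, which is \<open>z * N\<close> with \<open>N\<close> the
  squared norm of \<open>w\<close>, equals its own conjugate. Since \<open>N\<close> is real and
  nonzero, \<open>z\<close> is real, hence a root of the real characteristic polynomial, and so it
  has a real eigenvector.\<close>

lemma symmetric_real_mat_has_eigenvector:
  fixes A :: "real mat"
  assumes A: "A \<in> carrier_mat n n" and sym: "A\<^sup>T = A" and n: "n > 0"
  shows "\<exists>e v. eigenvector A v e"
proof -
  have hom: "comm_ring_hom complex_of_real" by unfold_locales auto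
  let ?A = "map_mat complex_of_real A"
  have A': "?A \<in> carrier_mat n n" using A by simp
  have "degree (char_poly ?A) = n" using degree_monic_char_poly[OF A'] by simp
  then obtain z where "poly (char_poly ?A) z = 0"
    using fundamental_theorem_of_algebra[of "char_poly ?A"] n constant_degree by (metis neq0_conv)
  then obtain w where w: "eigenvector ?A w z"
    using eigenvalue_root_char_poly[OF A'] unfolding eigenvalue_def by blast
  have wc: "w \<in> carrier_vec n" and w0: "w \<noteq> 0\<^sub>v n" and Aw: "?A *\<^sub>v w = z \<cdot>\<^sub>v w"
    using w A' unfolding eigenvector_def by auto
  have ent: "(\<Sum>j<n. complex_of_real (A $$ (i,j)) * w $ j) = z * w $ i" if "i < n" for i
  proof -
    have "(?A *\<^sub>v w) $ i = (\<Sum>j<n. complex_of_real (A $$ (i,j)) * w $ j)"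
      using that A wc by (auto simp: mult_mat_vec_def scalar_prod_def atLeast0LessThan intro!: sum.cong)
    then show ?thesis using Aw that wc by simp
  qed
  have symA: "A $$ (i,j) = A $$ (j,i)" if "i < n" "j < n" for i j
    using sym A that by (metis carrier_matD index_transpose_mat(1))
  define N where "N = (\<Sum>i<n. cnj (w $ i) * w $ i)"
  have N1: "z * N = (\<Sum>i<n. \<Sum>j<n. cnj (w $ i) * (complex_of_real (A $$ (i,j)) * w $ j))"
    unfolding N_def sum_distrib_left
    by (intro sum.cong refl) (simp add: ent[symmetric] sum_distrib_left[symmetric])
  have "cnj (z * N) = (\<Sum>i<n. \<Sum>j<n. w $ i * (complex_of_real (A $$ (i,j)) * cnj (w $ j)))"
    unfolding N1 by simp
  also have "\<dots> = (\<Sum>j<n. \<Sum>i<n. w $ i * (complex_of_real (A $$ (i,j)) * cnj (w $ j)))"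
    by (rule sum.swap)
  also have "\<dots> = z * N"
    unfolding N1 by (intro sum.cong refl) (auto simp: symA mult_ac)
  finally have conj: "cnj z * cnj N = z * N" by simp
  have Nr: "N = complex_of_real (\<Sum>i<n. (cmod (w $ i))\<^sup>2)"
    unfolding N_def of_real_sum by (intro sum.cong refl) (metis complex_norm_square mult.commute)
  have "N \<noteq> 0"
  proof
    assume "N = 0"
    then have "(\<Sum>i<n. (cmod (w $ i))\<^sup>2) = 0" unfolding Nr of_real_eq_0_iff .
    then have "\<forall>i<n. w $ i = 0" by (subst (asm) sum_nonneg_eq_0_iff) auto
    then have "w = 0\<^sub>v n" using wc by (intro eq_vecI) auto
    then show False using w0 by simp
  qed
  moreover have "cnj N = N" unfolding Nr by (rule complex_cnj_complex_of_real)
  ultimately have "cnj z = z" using conj by simp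
  then obtain e where e: "z = complex_of_real e" by (metis Reals_cases Reals_cnj_iff)
  have "poly (map_poly complex_of_real (char_poly A)) (complex_of_real e) = 0"
    using \<open>poly (char_poly ?A) z = 0\<close> unfolding e by (simp add: comm_ring_hom.char_poly_hom[OF hom A])
  then have "poly (char_poly A) e = 0" by simp
  then show ?thesis
    using eigenvalue_root_char_poly[OF A] unfolding eigenvalue_def by blast
qed

text \<open>The reflection \<open>I - 2 u u^T / s\<close> in the hyperplane orthogonal to
  \<open>u = v - e_0\<close>, where \<open>s\<close> is the squared norm of \<open>u\<close>,
  exchanges the unit vectors \<open>e_0\<close> and \<open>v\<close>. If \<open>s = 0\<close>, then
  \<open>v = e_0\<close> and the identity serves.\<close>

lemma householder_reflection:
  fixes v :: "real vec"
  assumes v: "v \<in> carrier_vec n" and unit: "(\<Sum>i<n. (v $ i)\<^sup>2) = 1" and n: "n > 0"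
  shows "\<exists>H. H \<in> carrier_mat n n \<and> H\<^sup>T = H \<and> H * H = 1\<^sub>m n \<and> H *\<^sub>v unit_vec n 0 = v"
proof -
  define u where "u i = v $ i - (if i = 0 then 1 else 0)" for i
  define s where "s = (\<Sum>i<n. u i * u i)"
  \<comment> \<open>Because \<open>v\<close> is a unit vector, \<open>s = 2 - 2 * v $ 0\<close>.
    Written as \<open>- 2 * u 0\<close>, this makes column 0 of \<open>H\<close> equal to
    \<open>e_0 + u\<close>, that is, \<open>v\<close>.\<close>
  have "s = (\<Sum>i<n. (v $ i)\<^sup>2 + (if i = 0 then 1 - 2 * v $ 0 else 0))"
    unfolding s_def by (intro sum.cong) (auto simp: u_def power2_eq_square algebra_simps)
  also have "\<dots> = - 2 * u 0"
    using n by (simp add: sum.distrib unit u_def)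
  finally have s: "s = - 2 * u 0" .
  show ?thesis
  proof (cases "s = 0")
    case True
    then have "\<forall>i<n. u i * u i = 0"
      unfolding s_def by (subst (asm) sum_nonneg_eq_0_iff) auto
    then have "v = unit_vec n 0"
      using v n by (intro eq_vecI) (auto simp: u_def unit_vec_def)
    then show ?thesis by (intro exI[of _ "1\<^sub>m n"]) auto
  next
    case False
    define H where "H = mat n n (\<lambda>(i,j). (if i = j then 1 else 0) - 2 * u i * u j / s)"
    have H: "H \<in> carrier_mat n n" by (simp add: H_def)
    have "H\<^sup>T = H" by (intro eq_matI) (auto simp: H_def)
    moreover have "H * H = 1\<^sub>m n"
    proof (intro eq_matI)
      fix i j assume "i < dim_row (1\<^sub>m n)" "j < dim_col (1\<^sub>m n)"
      then have ij: "i < n" "j < n" by auto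
      have "(H * H) $$ (i,j) = (\<Sum>l<n. H $$ (i,l) * H $$ (l,j))"
        using ij H by (simp add: scalar_prod_def atLeast0LessThan)
      also have "\<dots> = (\<Sum>l<n. (if l = i then (if i = j then 1 else 0) - 2 * u i * u j / s else 0)
          - (if l = j then 2 * u i * u j / s else 0) + (4 * u i * u j / s\<^sup>2) * (u l * u l))"
        using ij by (intro sum.cong) (auto simp: H_def algebra_simps power2_eq_square)
      also have "\<dots> = (if i = j then 1 else 0) - 4 * u i * u j / s + (4 * u i * u j / s\<^sup>2) * s"
        using ij by (simp add: sum.distrib sum_subtractf s_def sum_distrib_left)
      also have "\<dots> = (if i = j then 1 else 0)"
        using False by (simp add: power2_eq_square)
      finally show "(H * H) $$ (i,j) = 1\<^sub>m n $$ (i,j)" using ij by simp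
    qed (auto simp: H_def)
    moreover have "H *\<^sub>v unit_vec n 0 = v"
    proof (intro eq_vecI)
      fix i assume "i < dim_vec v"
      then have i: "i < n" using v by simp
      have "(H *\<^sub>v unit_vec n 0) $ i = H $$ (i,0)"
        using i n H by simp
      also have "\<dots> = (if i = 0 then 1 else 0) - 2 * u i * u 0 / s"
        using i n by (simp add: H_def)
      also have "2 * u i * u 0 / s = - u i" using False by (simp add: s)
      also have "(if i = 0 then 1 else 0) - - u i = v $ i" by (simp add: u_def)
      finally show "(H *\<^sub>v unit_vec n 0) $ i = v $ i" .
    qed (use H v in auto)
    ultimately show ?thesis using H by blast
  qed
qed

text \<open>Deflation: a reflection \<open>H\<close> moves \<open>e_0\<close> to a unit eigenvector
  of \<open>A\<close>, so \<open>B = H A H\<close> has \<open>e_0\<close> as an eigenvector. The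
  induction hypothesis diagonalizes the block \<open>C\<close> of \<open>B\<close> that remains
  after removing row and column 0.\<close>

lemma symmetric_real_mat_orthogonally_diagonalizable:
  fixes A :: "real mat"
  assumes "A \<in> carrier_mat n n" "A\<^sup>T = A"
  shows "\<exists>Q d. Q \<in> carrier_mat n n \<and> Q * Q\<^sup>T = 1\<^sub>m n \<and> Q\<^sup>T * Q = 1\<^sub>m n \<and> A = Q * mat_diag n d * Q\<^sup>T"
  using assms
proof (induction n arbitrary: A)
  case 0
  then show ?case by (intro exI[of _ "1\<^sub>m 0"] exI[of _ "\<lambda>_. 0"]) auto
next
  case (Suc n)
  note A = Suc.prems(1) and sym = Suc.prems(2)
  obtain e w where ew: "eigenvector A w e"
    using symmetric_real_mat_has_eigenvector[OF A sym] by blast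
  have w: "w \<in> carrier_vec (Suc n)" "w \<noteq> 0\<^sub>v (Suc n)" "A *\<^sub>v w = e \<cdot>\<^sub>v w"
    using ew A unfolding eigenvector_def by auto
  define r where "r = sqrt (\<Sum>i<Suc n. (w $ i)\<^sup>2)"
  have "(\<Sum>i<Suc n. (w $ i)\<^sup>2) \<noteq> 0"
  proof
    assume "(\<Sum>i<Suc n. (w $ i)\<^sup>2) = 0"
    then have "\<forall>i<Suc n. w $ i = 0" by (subst (asm) sum_nonneg_eq_0_iff) auto
    then show False using w by (metis carrier_vecD eq_vecI index_zero_vec)
  qed
  moreover have "(\<Sum>i<Suc n. (w $ i)\<^sup>2) \<ge> 0" by (intro sum_nonneg) auto
  ultimately have r: "r \<noteq> 0" "r\<^sup>2 = (\<Sum>i<Suc n. (w $ i)\<^sup>2)" by (auto simp: r_def)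
  define v where "v = (1 / r) \<cdot>\<^sub>v w"
  have v: "v \<in> carrier_vec (Suc n)" using w by (simp add: v_def)
  have "(\<Sum>i<Suc n. (v $ i)\<^sup>2) = (\<Sum>i<Suc n. (w $ i)\<^sup>2 / r\<^sup>2)"
    using w by (intro sum.cong) (auto simp: v_def power_divide)
  also have "\<dots> = 1" unfolding sum_divide_distrib[symmetric] r(2)[symmetric] using r(1) by simp
  finally have unit: "(\<Sum>i<Suc n. (v $ i)\<^sup>2) = 1" .
  have Av: "A *\<^sub>v v = e \<cdot>\<^sub>v v"
    unfolding v_def using w A by (simp add: mult_mat_vec smult_smult_assoc mult.commute)
  obtain H where H: "H \<in> carrier_mat (Suc n) (Suc n)" "H\<^sup>T = H" "H * H = 1\<^sub>m (Suc n)"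
      "H *\<^sub>v unit_vec (Suc n) 0 = v"
    using householder_reflection[OF v unit] by blast
  note assoc = assoc_mult_mat[where ?n\<^sub>1 = "Suc n" and ?n\<^sub>2 = "Suc n" and ?n\<^sub>3 = "Suc n" and ?n\<^sub>4 = "Suc n"]
  define B where "B = H * (A * H)"
  have B: "B \<in> carrier_mat (Suc n) (Suc n)" using A H by (simp add: B_def)
  have "B\<^sup>T = B"
    unfolding B_def using A H(1,2) sym
    by (simp add: transpose_mult[of _ "Suc n" "Suc n" _ "Suc n"] assoc)
  then have symB: "B $$ (i,j) = B $$ (j,i)" if "i < Suc n" "j < Suc n" for i j
    using B that by (metis carrier_matD index_transpose_mat(1))
  have Hv: "H *\<^sub>v v = unit_vec (Suc n) 0"
    using H assoc_mult_mat_vec[OF H(1) H(1), of "unit_vec (Suc n) 0"] by simp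
  have "B *\<^sub>v unit_vec (Suc n) 0 = H *\<^sub>v (A *\<^sub>v (H *\<^sub>v unit_vec (Suc n) 0))"
    unfolding B_def using A H(1)
    by (simp add: assoc_mult_mat_vec[of _ "Suc n" "Suc n" _ "Suc n"])
  also have "\<dots> = e \<cdot>\<^sub>v unit_vec (Suc n) 0"
    unfolding H(4) Av using H v by (simp add: mult_mat_vec Hv)
  finally have Be: "B *\<^sub>v unit_vec (Suc n) 0 = e \<cdot>\<^sub>v unit_vec (Suc n) 0" .
  have B0: "B $$ (i,0) = (if i = 0 then e else 0)" if "i < Suc n" for i
  proof -
    have "B $$ (i,0) = (B *\<^sub>v unit_vec (Suc n) 0) $ i" using B that by simp
    then show ?thesis unfolding Be using that by simp
  qed
  define C where "C = mat n n (\<lambda>(i,j). B $$ (Suc i, Suc j))"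
  have C: "C \<in> carrier_mat n n" "C\<^sup>T = C"
    by (auto simp: C_def symB intro!: eq_matI)
  from Suc.IH[OF C] obtain Q d where Q: "Q \<in> carrier_mat n n" "Q * Q\<^sup>T = 1\<^sub>m n" "Q\<^sup>T * Q = 1\<^sub>m n"
      "C = Q * mat_diag n d * Q\<^sup>T" by blast
  \<comment> \<open>\<open>case_nat e d\<close> puts \<open>e\<close> at index 0 and shifts the
    eigenvalues of \<open>C\<close> by one; \<open>F\<close> extends \<open>Q\<close> accordingly by
    a corner entry 1. The orthogonal matrix for \<open>A\<close> will be
    \<open>H * F\<close>.\<close>
  define D where "D = mat_diag (Suc n) (case_nat e d)"
  define F where "F = four_block_mat (1\<^sub>m 1) (0\<^sub>m 1 n) (0\<^sub>m n 1) Q"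
  have D: "D = four_block_mat (e \<cdot>\<^sub>m 1\<^sub>m 1) (0\<^sub>m 1 n) (0\<^sub>m n 1) (mat_diag n d)"
    unfolding D_def by (intro eq_matI) (auto simp: mat_diag_def split: nat.splits)
  have FT: "F\<^sup>T = four_block_mat (1\<^sub>m 1) (0\<^sub>m 1 n) (0\<^sub>m n 1) (Q\<^sup>T)"
    unfolding F_def using Q by (subst transpose_four_block_mat) auto
  have car: "F \<in> carrier_mat (Suc n) (Suc n)" "D \<in> carrier_mat (Suc n) (Suc n)"
    using Q four_block_carrier_mat[of "1\<^sub>m 1" 1 1 Q n n] by (auto simp: F_def D_def)
  have one: "1\<^sub>m (Suc n) = four_block_mat (1\<^sub>m 1) (0\<^sub>m 1 n) (0\<^sub>m n 1) (1\<^sub>m n :: real mat)"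
    by (intro eq_matI) auto
  have FFT: "F * F\<^sup>T = 1\<^sub>m (Suc n)" "F\<^sup>T * F = 1\<^sub>m (Suc n)"
    unfolding FT one unfolding F_def using Q
    by (subst mult_four_block_mat[of _ 1 1 _ n _ n _ _ 1 _ n]; auto)+
  \<comment> \<open>Column 0 of \<open>B\<close> is known from the eigenvector equation, and
    symmetry carries its zeros over to row 0.\<close>
  have "B = four_block_mat (e \<cdot>\<^sub>m 1\<^sub>m 1) (0\<^sub>m 1 n) (0\<^sub>m n 1) C"
  proof (intro eq_matI)
    fix i j assume "i < dim_row (four_block_mat (e \<cdot>\<^sub>m 1\<^sub>m 1) (0\<^sub>m 1 n) (0\<^sub>m n 1) C)"
      "j < dim_col (four_block_mat (e \<cdot>\<^sub>m 1\<^sub>m 1) (0\<^sub>m 1 n) (0\<^sub>m n 1) C)"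
    then have "i < Suc n" "j < Suc n" using C by auto
    then show "B $$ (i,j) = four_block_mat (e \<cdot>\<^sub>m 1\<^sub>m 1) (0\<^sub>m 1 n) (0\<^sub>m n 1) C $$ (i,j)"
      using C B0[of i] B0[of j] symB[of i j] by (cases i; cases j) (auto simp: C_def)
  qed (use B C in auto)
  moreover have "0\<^sub>m (Suc 0) n * mat_diag n d = 0\<^sub>m (Suc 0) n"
    by (rule left_mult_zero_mat) simp
  moreover have "Q * mat_diag n d * 0\<^sub>m n (Suc 0) = 0\<^sub>m n (Suc 0)"
    by (rule right_mult_zero_mat) (use Q in simp)
  moreover have "Q * mat_diag n d * Q\<^sup>T \<in> carrier_mat n n"
    using Q(4) C(1) by simp
  ultimately have BF: "B = F * D * F\<^sup>T"
    unfolding FT unfolding F_def D using Q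
    by (subst mult_four_block_mat[of _ 1 1 _ n _ n _ _ 1 _ n];
        (subst mult_four_block_mat[of _ 1 1 _ n _ n _ _ 1 _ n])?; auto)
  \<comment> \<open>\<open>H\<close> is its own inverse, so conjugating \<open>B\<close> by
    \<open>H\<close> once more returns \<open>A\<close>.\<close>
  have "H * (F * D * F\<^sup>T) * H = H * (H * (A * H)) * H" unfolding BF[symmetric] B_def ..
  also have "\<dots> = (H * H) * A * (H * H)" using A H(1) by (simp add: assoc del: H(3))
  also have "\<dots> = A" using A by (simp add: H(3))
  finally have "A = (H * F) * D * (F\<^sup>T * H)" using H(1) car by (simp add: assoc)
  moreover have T: "(H * F)\<^sup>T = F\<^sup>T * H" using H(1,2) car by (simp add: transpose_mult[of _ "Suc n" "Suc n" _ "Suc n"])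
  moreover have "(H * F) * (F\<^sup>T * H) = 1\<^sub>m (Suc n)"
  proof -
    have "(H * F) * (F\<^sup>T * H) = H * (F * F\<^sup>T) * H" using H(1) car by (simp add: assoc)
    then show ?thesis using H by (simp add: FFT)
  qed
  moreover have "(F\<^sup>T * H) * (H * F) = 1\<^sub>m (Suc n)"
  proof -
    have "(F\<^sup>T * H) * (H * F) = F\<^sup>T * (H * H) * F" using H(1) car by (simp add: assoc)
    then show ?thesis using H car by (simp add: FFT)
  qed
  ultimately show ?case
    unfolding D_def using H car by (intro exI[of _ "H * F"] exI[of _ "case_nat e d"]) auto
qed

subsection \<open>Counting nonpositive eigenvalues\<close>

lemma order_prod_linear_factors:
  fixes d :: "nat \<Rightarrow> 'a::field"
  shows "order a (\<Prod>l<n. [:- d l, 1:]) = card {l. l < n \<and> d l = a}"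
proof (induction n)
  case (Suc n)
  have nz: "(\<Prod>l<n. [:- d l, 1:]) * [:- d n, 1:] \<noteq> 0" by (auto simp: prod_zero_iff simp del: mult_pCons_right)
  have lin: "order a [:- d n, 1:] = (if d n = a then 1 else 0)"
    using order_power_n_n[of "d n" 1] by (auto intro: order_0I)
  have "{l. l < Suc n \<and> d l = a} = {l. l < n \<and> d l = a} \<union> (if d n = a then {n} else {})"
    by (auto simp: less_Suc_eq)
  then have "card {l. l < Suc n \<and> d l = a} = card {l. l < n \<and> d l = a} + (if d n = a then 1 else 0)"
    by simp
  then show ?case
    unfolding prod.lessThan_Suc order_mult[OF nz] lin Suc.IH by simp
qed simp

text \<open>The characteristic polynomial is a product of the linear factors of the
  \<open>d l\<close>, so the order of a root is the number of indices with that value. Summing over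
  the nonpositive values regroups the indices by value.\<close>

lemma num_nonpos_eigs_if_similar_diag:
  assumes "similar_mat A (mat_diag n d)"
  shows "num_nonpos_eigs A = card {l. l < n \<and> d l \<le> 0}"
proof -
  have "char_poly A = char_poly (mat_diag n d)" by (rule char_poly_similar[OF assms])
  also have "\<dots> = (\<Prod>a\<leftarrow>diag_mat (mat_diag n d). [:- a, 1:])"
    by (rule char_poly_upper_triangular[of _ n]) (auto simp: mat_diag_def upper_triangular_def)
  also have "diag_mat (mat_diag n d) = map d [0..<n]"
    by (auto simp: diag_mat_def mat_diag_def)
  also have "(\<Prod>a\<leftarrow>map d [0..<n]. [:- a, 1:]) = (\<Prod>l<n. [:- d l, 1:])"
    using prod.distinct_set_conv_list[of "[0..<n]" "\<lambda>l. [:- d l, 1:]"]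
    by (simp add: o_def atLeast0LessThan)
  finally have cp: "char_poly A = (\<Prod>l<n. [:- d l, 1:])" .
  let ?S = "{l. l < n \<and> d l \<le> 0}"
  have "num_nonpos_eigs A = (\<Sum>a\<in>d ` ?S. card {l. l < n \<and> d l = a})"
    unfolding num_nonpos_eigs_def cp order_prod_linear_factors
    by (intro sum.cong) (auto simp: poly_prod)
  also have "\<dots> = (\<Sum>a\<in>d ` ?S. \<Sum>l\<in>{l \<in> ?S. d l = a}. 1)"
    by (intro sum.cong) (auto intro!: arg_cong[of _ _ card])
  also have "\<dots> = card ?S" by (subst sum.group) auto
  finally show ?thesis .
qed

text \<open>The only shape in which the later dimension counts use the spectral theorem: the
  functionals \<open>q l\<close> are the rows of \<open>Q^T\<close>, and the last property is the
  injectivity of \<open>Q^T\<close>.\<close>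

lemma symmetric_form_diagonalization:
  fixes A :: "real mat"
  assumes A: "A \<in> carrier_mat n n" and sym: "A\<^sup>T = A"
  obtains q d where "num_nonpos_eigs A = card {l. l < n \<and> d l \<le> 0}"
    and "\<And>x. (\<Sum>i<n. \<Sum>j<n. A $$ (i,j) * x i * x j) = (\<Sum>l<n. d l * (\<Sum>i<n. q l i * x i)\<^sup>2)"
    and "\<And>x. (\<forall>l<n. (\<Sum>i<n. q l i * x i) = 0) \<Longrightarrow> \<forall>i<n. x i = 0"
proof -
  obtain Q d where Q: "Q \<in> carrier_mat n n" "Q * Q\<^sup>T = 1\<^sub>m n" "Q\<^sup>T * Q = 1\<^sub>m n"
      and AQ: "A = Q * mat_diag n d * Q\<^sup>T"
    using symmetric_real_mat_orthogonally_diagonalizable[OF A sym] by blast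
  define q where "q l i = Q $$ (i,l)" for l i
  have "similar_mat A (mat_diag n d)"
    by (rule similar_matI[of _ _ Q "Q\<^sup>T" n]) (use A Q AQ in auto)
  then have "num_nonpos_eigs A = card {l. l < n \<and> d l \<le> 0}"
    by (rule num_nonpos_eigs_if_similar_diag)
  moreover have "(\<Sum>i<n. \<Sum>j<n. A $$ (i,j) * x i * x j) = (\<Sum>l<n. d l * (\<Sum>i<n. q l i * x i)\<^sup>2)" for x
  proof -
    have ent: "A $$ (i,j) = (\<Sum>l<n. q l i * d l * q l j)" if "i < n" "j < n" for i j
      unfolding AQ mat_diag_mult_right[OF Q(1)] using that Q(1)
      by (auto simp: scalar_prod_def atLeast0LessThan q_def intro!: sum.cong)
    have "(\<Sum>i<n. \<Sum>j<n. A $$ (i,j) * x i * x j)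
        = (\<Sum>i<n. \<Sum>j<n. \<Sum>l<n. d l * ((q l i * x i) * (q l j * x j)))"
      by (intro sum.cong refl) (simp add: ent sum_distrib_left sum_distrib_right mult_ac)
    also have "\<dots> = (\<Sum>i<n. \<Sum>l<n. \<Sum>j<n. d l * ((q l i * x i) * (q l j * x j)))"
      by (intro sum.cong refl sum.swap)
    also have "\<dots> = (\<Sum>l<n. \<Sum>i<n. \<Sum>j<n. d l * ((q l i * x i) * (q l j * x j)))"
      by (rule sum.swap)
    also have "\<dots> = (\<Sum>l<n. d l * (\<Sum>i<n. q l i * x i)\<^sup>2)"
      unfolding power2_eq_square sum_product by (simp only: sum_distrib_left)
    finally show ?thesis .
  qed
  moreover have "\<forall>i<n. x i = 0" if x: "\<forall>l<n. (\<Sum>i<n. q l i * x i) = 0" for x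
  proof -
    have "Q\<^sup>T *\<^sub>v vec n x = 0\<^sub>v n"
      using x Q(1) by (intro eq_vecI) (auto simp: scalar_prod_def atLeast0LessThan q_def)
    then have "(Q * Q\<^sup>T) *\<^sub>v vec n x = 0\<^sub>v n"
      using Q(1) by (subst assoc_mult_mat_vec[of _ n n _ n]) auto
    then have "vec n x = 0\<^sub>v n" by (simp add: Q(2))
    then show ?thesis by (metis index_vec index_zero_vec(1))
  qed
  ultimately show thesis by (rule that)
qed

section \<open>Eigenvalue counts from the sign of the quadratic form on a subspace\<close>

text \<open>The dimension count behind Sylvester's law of inertia. Otherwise the functionals
  \<open>a j\<close> and the \<open>q l\<close> with \<open>d l \<le> 0\<close> would number fewer
  than \<open>n\<close> and share a nonzero kernel vector. There the form is a sum of nonnegative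
  terms and also nonpositive, so every \<open>q l\<close> vanishes, contradicting
  injectivity.\<close>

lemma num_nonpos_eigs_ge_if_form_nonpos:
  fixes A :: "real mat" and a :: "'j \<Rightarrow> nat \<Rightarrow> real"
  assumes A: "A \<in> carrier_mat n n" "A\<^sup>T = A" and J: "finite J"
    and form: "\<And>x. \<forall>j\<in>J. (\<Sum>i<n. a j i * x i) = 0 \<Longrightarrow> (\<Sum>i<n. \<Sum>j<n. A $$ (i,j) * x i * x j) \<le> 0"
  shows "n \<le> num_nonpos_eigs A + card J"
proof (rule ccontr)
  assume less: "\<not> ?thesis"
  obtain q d where N: "num_nonpos_eigs A = card {l. l < n \<and> d l \<le> 0}"
    and diag: "\<And>x. (\<Sum>i<n. \<Sum>j<n. A $$ (i,j) * x i * x j) = (\<Sum>l<n. d l * (\<Sum>i<n. q l i * x i)\<^sup>2)"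
    and inj: "\<And>x. (\<forall>l<n. (\<Sum>i<n. q l i * x i) = 0) \<Longrightarrow> \<forall>i<n. x i = 0"
    by (rule symmetric_form_diagonalization[OF A]) (rule that)
  let ?L = "{l. l < n \<and> d l \<le> 0}"
  \<comment> \<open>The disjoint sum indexes both families of functionals as one linear system, with
    \<open>case_sum a q\<close> as coefficients.\<close>
  have "card (J <+> ?L) < card {..<n}"
    using less N J by (simp add: card_Plus)
  then have "\<exists>x. (\<exists>i\<in>{..<n}. x i \<noteq> 0) \<and> (\<forall>j\<in>J <+> ?L. (\<Sum>i<n. case_sum a q j i * x i) = 0)"
    using J by (intro homogeneous_system_nontrivial_solution finite_Plus) simp_all
  then obtain x where x: "\<exists>i<n. x i \<noteq> 0" "\<forall>j\<in>J <+> ?L. (\<Sum>i<n. case_sum a q j i * x i) = 0"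
    by blast
  have xJ: "\<forall>j\<in>J. (\<Sum>i<n. a j i * x i) = 0"
  proof
    fix j assume "j \<in> J"
    then show "(\<Sum>i<n. a j i * x i) = 0" using bspec[OF x(2) InlI] by simp
  qed
  have xL: "(\<Sum>i<n. q l i * x i) = 0" if "l < n" "d l \<le> 0" for l
    using bspec[OF x(2) InrI, of l] that by simp
  have nn: "d l * (\<Sum>i<n. q l i * x i)\<^sup>2 \<ge> 0" if "l < n" for l
    using xL[OF that] by (cases "d l \<le> 0") auto
  have "(\<Sum>l<n. d l * (\<Sum>i<n. q l i * x i)\<^sup>2) = 0"
    using form[OF xJ] nn unfolding diag by (intro antisym sum_nonneg) auto
  then have "\<forall>l<n. d l * (\<Sum>i<n. q l i * x i)\<^sup>2 = 0"
    using nn by (subst (asm) sum_nonneg_eq_0_iff) auto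
  then have "\<forall>l<n. (\<Sum>i<n. q l i * x i) = 0" using xL by (metis mult_eq_0_iff order_refl zero_eq_power2)
  then show False using inj x(1) by blast
qed

text \<open>The dual count: a nonzero vector killed by all \<open>a j\<close> and by the
  \<open>q l\<close> with \<open>d l > 0\<close> would make the form at most 0, against the assumed
  positivity.\<close>

lemma num_nonpos_eigs_le_if_form_pos:
  fixes A :: "real mat" and a :: "'j \<Rightarrow> nat \<Rightarrow> real"
  assumes A: "A \<in> carrier_mat n n" "A\<^sup>T = A" and J: "finite J"
    and form: "\<And>x. \<forall>j\<in>J. (\<Sum>i<n. a j i * x i) = 0 \<Longrightarrow> \<exists>i<n. x i \<noteq> 0 \<Longrightarrow>
      (\<Sum>i<n. \<Sum>j<n. A $$ (i,j) * x i * x j) > 0"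
  shows "num_nonpos_eigs A \<le> card J"
proof (rule ccontr)
  assume less: "\<not> ?thesis"
  obtain q d where N: "num_nonpos_eigs A = card {l. l < n \<and> d l \<le> 0}"
    and diag: "\<And>x. (\<Sum>i<n. \<Sum>j<n. A $$ (i,j) * x i * x j) = (\<Sum>l<n. d l * (\<Sum>i<n. q l i * x i)\<^sup>2)"
    and inj: "\<And>x. (\<forall>l<n. (\<Sum>i<n. q l i * x i) = 0) \<Longrightarrow> \<forall>i<n. x i = 0"
    by (rule symmetric_form_diagonalization[OF A]) (rule that)
  let ?L = "{l. l < n \<and> d l > 0}"
  have "card {l. l < n \<and> d l \<le> 0} + card ?L = card ({l. l < n \<and> d l \<le> 0} \<union> ?L)"
    by (rule card_Un_disjoint[symmetric]) auto
  also have "{l. l < n \<and> d l \<le> 0} \<union> ?L = {..<n}" by auto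
  finally have "card {l. l < n \<and> d l \<le> 0} + card ?L = n" by simp
  then have "card (J <+> ?L) < card {..<n}"
    using less N J by (simp add: card_Plus)
  then have "\<exists>x. (\<exists>i\<in>{..<n}. x i \<noteq> 0) \<and> (\<forall>j\<in>J <+> ?L. (\<Sum>i<n. case_sum a q j i * x i) = 0)"
    using J by (intro homogeneous_system_nontrivial_solution finite_Plus) simp_all
  then obtain x where x: "\<exists>i<n. x i \<noteq> 0" "\<forall>j\<in>J <+> ?L. (\<Sum>i<n. case_sum a q j i * x i) = 0"
    by blast
  have xJ: "\<forall>j\<in>J. (\<Sum>i<n. a j i * x i) = 0"
  proof
    fix j assume "j \<in> J"
    then show "(\<Sum>i<n. a j i * x i) = 0" using bspec[OF x(2) InlI] by simp
  qed
  have xL: "(\<Sum>i<n. q l i * x i) = 0" if "l < n" "d l > 0" for l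
    using bspec[OF x(2) InrI, of l] that by simp
  have "d l * (\<Sum>i<n. q l i * x i)\<^sup>2 \<le> 0" if "l < n" for l
    using xL[OF that] by (cases "d l > 0") (auto simp: mult_nonpos_nonneg)
  then have "(\<Sum>l<n. d l * (\<Sum>i<n. q l i * x i)\<^sup>2) \<le> 0" by (intro sum_nonpos) auto
  then show False using form[OF xJ x(1)] unfolding diag by simp
qed

section \<open>Nonpositive eigenvalues forced by independent sets and cliques\<close>

lemma adj_matrix_carrier: "adj_matrix n E \<in> carrier_mat n n"
  by (simp add: adj_matrix_def)

lemma adj_matrix_symmetric: "is_graph n E \<Longrightarrow> (adj_matrix n E)\<^sup>T = adj_matrix n E"
  by (intro eq_matI) (auto simp: adj_matrix_def is_graph_def)

text \<open>The functionals are the coordinates outside \<open>S\<close>. On their common kernel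
  every term of the form vanishes, and there are \<open>n - card S\<close> of them.\<close>

lemma independent_set_card_le_num_nonpos_eigs:
  assumes G: "is_graph n E" and S: "independent_set n E S"
  shows "card S \<le> num_nonpos_eigs (adj_matrix n E)"
proof -
  have sub: "S \<subseteq> {..<n}" using S by (auto simp: independent_set_def)
  have "n \<le> num_nonpos_eigs (adj_matrix n E) + card ({..<n} - S)"
  proof (rule num_nonpos_eigs_ge_if_form_nonpos[OF adj_matrix_carrier adj_matrix_symmetric[OF G],
        where a = "\<lambda>j i. if i = j then 1 else 0"])
    fix x :: "nat \<Rightarrow> real"
    assume "\<forall>j\<in>{..<n} - S. (\<Sum>i<n. (if i = j then 1 else 0) * x i) = 0"
    then have "x i = 0" if "i < n" "i \<notin> S" for i
      using that by (auto simp: if_distrib[of "\<lambda>c. c * _"] cong: if_cong)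
    then have "adj_matrix n E $$ (i,j) * x i * x j = 0" if "i < n" "j < n" for i j
      using that S by (cases "i \<in> S"; cases "j \<in> S") (auto simp: adj_matrix_def independent_set_def)
    then have "(\<Sum>i<n. \<Sum>j<n. adj_matrix n E $$ (i,j) * x i * x j) = 0"
      by (intro sum.neutral ballI) simp
    then show "(\<Sum>i<n. \<Sum>j<n. adj_matrix n E $$ (i,j) * x i * x j) \<le> 0" by simp
  qed auto
  moreover have "card ({..<n} - S) = n - card S" "card S \<le> n"
    using sub card_mono[OF _ sub] finite_subset[OF sub] by (simp_all add: card_Diff_subset)
  ultimately show ?thesis by simp
qed

text \<open>On vectors supported on a clique the form is the squared coordinate sum minus the
  squared norm. Requiring the sum to be 0 costs one further functional, hence the
  \<open>Suc\<close>.\<close>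

lemma clique_card_le_Suc_num_nonpos_eigs:
  assumes G: "is_graph n E" and S: "Defs.clique n E S"
  shows "card S \<le> Suc (num_nonpos_eigs (adj_matrix n E))"
proof -
  have sub: "S \<subseteq> {..<n}" using S by (auto simp: Defs.clique_def)
  \<comment> \<open>\<open>None\<close> stands for the coordinate sum, \<open>Some j\<close> for the
    coordinate \<open>j\<close> outside \<open>S\<close>.\<close>
  let ?J = "insert None (Some ` ({..<n} - S))"
  have "n \<le> num_nonpos_eigs (adj_matrix n E) + card ?J"
  proof (rule num_nonpos_eigs_ge_if_form_nonpos[OF adj_matrix_carrier adj_matrix_symmetric[OF G],
        where a = "\<lambda>j i. case j of None \<Rightarrow> 1 | Some j \<Rightarrow> if i = j then 1 else 0"])
    fix x :: "nat \<Rightarrow> real"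
    assume x: "\<forall>j\<in>?J. (\<Sum>i<n. (case j of None \<Rightarrow> 1 | Some j \<Rightarrow> if i = j then 1 else 0) * x i) = 0"
    have x0: "x i = 0" if "i < n" "i \<notin> S" for i
      using bspec[OF x, of "Some i"] that by (auto simp: if_distrib[of "\<lambda>c. c * _"] cong: if_cong)
    have "adj_matrix n E $$ (i,j) * x i * x j = x i * x j - (if i = j then (x i)\<^sup>2 else 0)"
      if "i < n" "j < n" for i j
      using that S x0[of i] x0[of j] G
      by (cases "i \<in> S"; cases "j \<in> S") (auto simp: adj_matrix_def Defs.clique_def is_graph_def power2_eq_square)
    then have "(\<Sum>i<n. \<Sum>j<n. adj_matrix n E $$ (i,j) * x i * x j)
        = (\<Sum>i<n. \<Sum>j<n. x i * x j - (if i = j then (x i)\<^sup>2 else 0))"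
      by (intro sum.cong) auto
    also have "\<dots> = (\<Sum>i<n. x i) * (\<Sum>j<n. x j) - (\<Sum>i<n. (x i)\<^sup>2)"
      by (simp add: sum_subtractf sum_product)
    also have "(\<Sum>i<n. x i) = 0" using bspec[OF x, of None] by simp
    finally show "(\<Sum>i<n. \<Sum>j<n. adj_matrix n E $$ (i,j) * x i * x j) \<le> 0"
      by (simp add: sum_nonneg)
  qed auto
  moreover have "card ?J = Suc (n - card S)" "card S \<le> n"
    using sub card_mono[OF _ sub] finite_subset[OF sub]
    by (auto simp: card_Diff_subset card_image card_insert_if)
  ultimately show ?thesis by simp
qed

subsection \<open>The two bounds\<close>

text \<open>A \<open>LEAST\<close> has its defining property only once some number is known to have
  it. Ramsey's theorem supplies one, after the edge relation is turned into a set \<open>F\<close>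
  of unordered pairs.\<close>

lemma ramsey_num_property:
  assumes "is_graph m E" "m \<ge> ramsey_num a b"
  shows "(\<exists>S. independent_set m E S \<and> card S = a) \<or> (\<exists>S. Defs.clique m E S \<and> card S = b)"
proof -
  let ?P = "\<lambda>N. \<forall>m\<ge>N. \<forall>E. is_graph m E \<longrightarrow>
      (\<exists>S. independent_set m E S \<and> card S = a) \<or> (\<exists>S. Defs.clique m E S \<and> card S = b)"
  obtain r where r: "\<forall>(V::nat set) (F::nat set set). finite V \<and> card V \<ge> r \<longrightarrow>
      (\<exists>R \<subseteq> V. card R = b \<and> Ramsey.clique R F \<or> card R = a \<and> indep R F)"
    using ramsey2[of b a] by blast
  have "?P r"
  proof (intro allI impI)
    fix m E assume m: "m \<ge> r" and G: "is_graph m E"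
    define F where "F = {{i, j} |i j. i < m \<and> j < m \<and> E i j}"
    have F: "{i, j} \<in> F \<longleftrightarrow> E i j" if "i < m" "j < m" for i j
      using that G by (auto simp: F_def doubleton_eq_iff is_graph_def)
    obtain R where R: "R \<subseteq> {0..<m}" "card R = b \<and> Ramsey.clique R F \<or> card R = a \<and> indep R F"
      using r[rule_format, of "{0..<m}" F] m by auto
    have "Defs.clique m E R" if "Ramsey.clique R F"
      unfolding Defs.clique_def
    proof (intro conjI ballI impI)
      fix i j assume ij: "i \<in> R" "j \<in> R" "i \<noteq> j"
      then have "{i, j} \<in> F" using that by (simp add: Ramsey.clique_def)
      moreover have "i < m" "j < m" using ij R(1) by auto
      ultimately show "E i j" using F by blast
    qed (fact R(1))
    moreover have "independent_set m E R" if "indep R F"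
      unfolding independent_set_def
    proof (intro conjI ballI)
      fix i j assume ij: "i \<in> R" "j \<in> R"
      then have lt: "i < m" "j < m" using R(1) by auto
      show "\<not> E i j"
      \<comment> \<open>\<open>indep\<close> speaks of distinct vertices only, while
        \<open>independent_set\<close> also covers \<open>i = j\<close>, where irreflexivity of the
        graph applies.\<close>
      proof (cases "i = j")
        case True
        then show ?thesis using G lt by (simp add: is_graph_def)
      next
        case False
        then have "{i, j} \<notin> F" using that ij by (simp add: indep_def)
        then show ?thesis using F[OF lt] by simp
      qed
    qed (fact R(1))
    ultimately show "(\<exists>S. independent_set m E S \<and> card S = a) \<or> (\<exists>S. Defs.clique m E S \<and> card S = b)"
      using R(2) by blast
  qed
  then have "?P (ramsey_num a b)" unfolding ramsey_num_def by (rule LeastI)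
  then show ?thesis using assms by blast
qed

text \<open>The clique bound loses one, which is why the second Ramsey argument is
  \<open>k + 1\<close>.\<close>

lemma num_nonpos_eigs_ge_if_ramsey_num_le:
  assumes G: "is_graph m E" and m: "m \<ge> ramsey_num k (k + 1)"
  shows "num_nonpos_eigs (adj_matrix m E) \<ge> k"
  using ramsey_num_property[OF G m] independent_set_card_le_num_nonpos_eigs[OF G]
    clique_card_le_Suc_num_nonpos_eigs[OF G] by fastforce

text \<open>The Ramsey number shows that the \<open>LEAST\<close> in \<open>NPO\<close> ranges over
  a nonempty set. The lower bound uses this contrapositively: one graph with too few nonpositive
  eigenvalues has fewer than \<open>NPO k\<close> vertices.\<close>

lemma NPO_property:
  assumes "is_graph m E" "m \<ge> NPO k"
  shows "num_nonpos_eigs (adj_matrix m E) \<ge> k"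
proof -
  have "\<forall>m\<ge>ramsey_num k (k + 1). \<forall>E. is_graph m E \<longrightarrow> num_nonpos_eigs (adj_matrix m E) \<ge> k"
    using num_nonpos_eigs_ge_if_ramsey_num_le by blast
  then have "\<forall>m\<ge>NPO k. \<forall>E. is_graph m E \<longrightarrow> num_nonpos_eigs (adj_matrix m E) \<ge> k"
    unfolding NPO_def by (rule LeastI)
  then show ?thesis using assms by blast
qed

section \<open>The graph on singletons and pairs and its quadratic form\<close>

text \<open>\<open>f\<close> numbers the singletons and pairs. The equivalence merges all cases:
  sets of equal size are joined when disjoint, sets of different size when they meet, which for a
  singleton and a pair means containment.\<close>

definition singleton_pair_adj :: "(nat \<Rightarrow> nat set) \<Rightarrow> nat \<Rightarrow> nat \<Rightarrow> bool" where
  "singleton_pair_adj f i j \<longleftrightarrow> (card (f i) = card (f j) \<longleftrightarrow> f i \<inter> f j = {})"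

lemma is_graph_singleton_pair_adj:
  assumes "\<forall>i<n. f i \<noteq> {}"
  shows "is_graph n (singleton_pair_adj f)"
  using assms by (auto simp: is_graph_def singleton_pair_adj_def)

text \<open>The coefficients of the functional \<open>t c\<close> from the overview.\<close>

definition incidence_sign :: "(nat \<Rightarrow> nat set) \<Rightarrow> nat \<Rightarrow> nat \<Rightarrow> real" where
  "incidence_sign f c i = (if c \<in> f i then (if card (f i) = 1 then - 1 else 1) else 0)"

lemma card_inter_eq_1:
  assumes "finite u" "finite v" "card u \<le> 2" "card v \<le> 2" "u \<noteq> v" "card u \<le> card v" "u \<inter> v \<noteq> {}"
  shows "card (u \<inter> v) = 1"
proof -
  have "card (u \<inter> v) > 0" using assms by (simp add: card_gt_0_iff)
  moreover have "card (u \<inter> v) < 2"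
  proof (rule ccontr)
    assume "\<not> card (u \<inter> v) < 2"
    moreover have "card (u \<inter> v) \<le> card u" "card (u \<inter> v) \<le> card v"
      using assms by (auto intro: card_mono)
    ultimately have "card (u \<inter> v) = card u" "card (u \<inter> v) = card v" using assms by auto
    then show False using assms card_subset_eq[of u "u \<inter> v"] card_subset_eq[of v "u \<inter> v"] by auto
  qed
  ultimately show ?thesis by simp
qed

lemma sum_incidence_sign_mult:
  assumes "f i \<subseteq> {..<k}"
  shows "(\<Sum>c<k. incidence_sign f c i * incidence_sign f c j) =
    (if card (f i) = 1 then - 1 else 1) * (if card (f j) = 1 then - 1 else 1) * real (card (f i \<inter> f j))"
proof -
  let ?s = "\<lambda>i. if card (f i) = 1 then - 1 else 1 :: real"
  have "(\<Sum>c<k. incidence_sign f c i * incidence_sign f c j)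
      = (\<Sum>c\<in>{..<k}. if c \<in> f i \<inter> f j then ?s i * ?s j else 0)"
    by (intro sum.cong) (auto simp: incidence_sign_def)
  also have "\<dots> = (\<Sum>c\<in>{..<k} \<inter> (f i \<inter> f j). ?s i * ?s j)"
    by (simp only: sum.inter_restrict[OF finite_lessThan])
  also have "{..<k} \<inter> (f i \<inter> f j) = f i \<inter> f j" using assms by auto
  finally show ?thesis by simp
qed

text \<open>The sum over \<open>c\<close> is, up to sign, the size of the intersection, which is at
  most 1 for distinct vertices. Equal sizes give 1 minus it, different sizes give it with a plus
  sign. On the diagonal a singleton gives \<open>1 - 1\<close>, whereas a pair gives
  \<open>1 - 2\<close> and needs the extra \<open>of_bool\<close> term.\<close>

lemma singleton_pair_adj_entry:
  assumes i: "f i \<subseteq> {..<k}" "card (f i) = 1 \<or> card (f i) = 2"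
    and j: "f j \<subseteq> {..<k}" "card (f j) = 1 \<or> card (f j) = 2"
    and inj: "f i = f j \<longleftrightarrow> i = j"
  shows "(if singleton_pair_adj f i j then 1 else 0 :: real) =
    of_bool (card (f i) = 2) * of_bool (card (f j) = 2)
    + of_bool (card (f i) = 1) * of_bool (card (f j) = 1)
    + of_bool (i = j \<and> card (f i) = 2)
    - (\<Sum>c<k. incidence_sign f c i * incidence_sign f c j)"
proof -
  have fin: "finite (f i)" "finite (f j)" using i j finite_subset by blast+
  consider "i = j" | "i \<noteq> j" "f i \<inter> f j = {}" | "i \<noteq> j" "f i \<inter> f j \<noteq> {}" by blast
  then show ?thesis
  proof cases
    case 1
    have "f j \<noteq> {}" using j by auto
    then show ?thesis unfolding sum_incidence_sign_mult[where f = f, OF i(1)] using 1 j(2)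
      by (auto simp: singleton_pair_adj_def)
  next
    case 2
    then show ?thesis unfolding sum_incidence_sign_mult[where f = f, OF i(1)] using i(2) j(2)
      by (auto simp: singleton_pair_adj_def)
  next
    case 3
    then have "card (f i \<inter> f j) = 1"
      using card_inter_eq_1[of "f i" "f j"] card_inter_eq_1[of "f j" "f i"] fin i(2) j(2) inj
      by (auto simp: Int_commute)
    then show ?thesis unfolding sum_incidence_sign_mult[where f = f, OF i(1)] using 3 i(2) j(2)
      by (auto simp: singleton_pair_adj_def)
  qed
qed

lemma singleton_pair_adj_form:
  fixes x :: "nat \<Rightarrow> real"
  assumes f: "\<And>i. i < n \<Longrightarrow> f i \<subseteq> {..<k}" "\<And>i. i < n \<Longrightarrow> card (f i) = 1 \<or> card (f i) = 2"
    and inj: "inj_on f {..<n}"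
  shows "(\<Sum>i<n. \<Sum>j<n. adj_matrix n (singleton_pair_adj f) $$ (i,j) * x i * x j) =
    (\<Sum>i<n. of_bool (card (f i) = 2) * x i)\<^sup>2 + (\<Sum>i<n. of_bool (card (f i) = 1) * x i)\<^sup>2
    + (\<Sum>i<n. of_bool (card (f i) = 2) * (x i)\<^sup>2) - (\<Sum>c<k. (\<Sum>i<n. incidence_sign f c i * x i)\<^sup>2)"
proof -
  have sq: "(\<Sum>i<n. g i * x i)\<^sup>2 = (\<Sum>i<n. \<Sum>j<n. g i * g j * x i * x j)" for g :: "nat \<Rightarrow> real"
    unfolding power2_eq_square sum_product by (simp add: mult_ac)
  have diag: "(\<Sum>i<n. of_bool (card (f i) = 2) * (x i)\<^sup>2)
      = (\<Sum>i<n. \<Sum>j<n. of_bool (i = j \<and> card (f i) = 2) * x i * x j)"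
  proof (intro sum.cong refl)
    fix i assume i: "i \<in> {..<n}"
    have "(\<Sum>j<n. of_bool (i = j \<and> card (f i) = 2) * x i * x j)
        = (\<Sum>j<n. if j = i then of_bool (card (f i) = 2) * (x i)\<^sup>2 else 0)"
      by (intro sum.cong) (auto simp: power2_eq_square)
    then show "of_bool (card (f i) = 2) * (x i)\<^sup>2 = (\<Sum>j<n. of_bool (i = j \<and> card (f i) = 2) * x i * x j)"
      using i by simp
  qed
  have "(\<Sum>c<k. (\<Sum>i<n. incidence_sign f c i * x i)\<^sup>2)
      = (\<Sum>c<k. \<Sum>i<n. \<Sum>j<n. incidence_sign f c i * incidence_sign f c j * x i * x j)"
    by (simp add: sq)
  also have "\<dots> = (\<Sum>i<n. \<Sum>c<k. \<Sum>j<n. incidence_sign f c i * incidence_sign f c j * x i * x j)"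
    by (rule sum.swap)
  also have "\<dots> = (\<Sum>i<n. \<Sum>j<n. \<Sum>c<k. incidence_sign f c i * incidence_sign f c j * x i * x j)"
    by (intro sum.cong refl sum.swap)
  also have "\<dots> = (\<Sum>i<n. \<Sum>j<n. (\<Sum>c<k. incidence_sign f c i * incidence_sign f c j) * x i * x j)"
    by (simp add: sum_distrib_right)
  finally have cs: "(\<Sum>c<k. (\<Sum>i<n. incidence_sign f c i * x i)\<^sup>2) = \<dots>" .
  have "(\<Sum>i<n. \<Sum>j<n. adj_matrix n (singleton_pair_adj f) $$ (i,j) * x i * x j) =
    (\<Sum>i<n. \<Sum>j<n. of_bool (card (f i) = 2) * of_bool (card (f j) = 2) * x i * x j
      + of_bool (card (f i) = 1) * of_bool (card (f j) = 1) * x i * x j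
      + of_bool (i = j \<and> card (f i) = 2) * x i * x j
      - (\<Sum>c<k. incidence_sign f c i * incidence_sign f c j) * x i * x j)"
  proof (intro sum.cong refl)
    fix i j assume "i \<in> {..<n}" "j \<in> {..<n}"
    then have ij: "i < n" "j < n" by auto
    then have "adj_matrix n (singleton_pair_adj f) $$ (i,j) = (if singleton_pair_adj f i j then 1 else 0)"
      by (simp add: adj_matrix_def)
    also have "\<dots> = of_bool (card (f i) = 2) * of_bool (card (f j) = 2)
      + of_bool (card (f i) = 1) * of_bool (card (f j) = 1)
      + of_bool (i = j \<and> card (f i) = 2)
      - (\<Sum>c<k. incidence_sign f c i * incidence_sign f c j)"
      using ij f inj by (intro singleton_pair_adj_entry) (auto dest: inj_onD)
    finally show "adj_matrix n (singleton_pair_adj f) $$ (i,j) * x i * x j =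
      of_bool (card (f i) = 2) * of_bool (card (f j) = 2) * x i * x j
      + of_bool (card (f i) = 1) * of_bool (card (f j) = 1) * x i * x j
      + of_bool (i = j \<and> card (f i) = 2) * x i * x j
      - (\<Sum>c<k. incidence_sign f c i * incidence_sign f c j) * x i * x j"
      by (simp only: distrib_right left_diff_distrib)
  qed
  then show ?thesis
    unfolding sq[of "\<lambda>i. of_bool (card (f i) = 2)"] sq[of "\<lambda>i. of_bool (card (f i) = 1)"] diag cs
    by (simp only: sum.distrib sum_subtractf)
qed

text \<open>The \<open>k - 1\<close> functionals are the differences of \<open>t c\<close> and
  \<open>t 0\<close> for \<open>c\<close> in \<open>{1..<k}\<close>. On their common kernel the
  inequality of the overview shows that the form is nonnegative; the equality case then has to be
  excluded for nonzero \<open>x\<close>.\<close>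

lemma num_nonpos_eigs_singleton_pair_adj_le:
  assumes k: "k \<ge> 5"
    and f: "\<And>i. i < n \<Longrightarrow> f i \<subseteq> {..<k}" "\<And>i. i < n \<Longrightarrow> card (f i) = 1 \<or> card (f i) = 2"
    and inj: "inj_on f {..<n}"
  shows "num_nonpos_eigs (adj_matrix n (singleton_pair_adj f)) \<le> k - 1"
proof -
  have G: "is_graph n (singleton_pair_adj f)"
    using f(2) by (intro is_graph_singleton_pair_adj) fastforce
  have "num_nonpos_eigs (adj_matrix n (singleton_pair_adj f)) \<le> card {1..<k}"
  proof (rule num_nonpos_eigs_le_if_form_pos[OF adj_matrix_carrier adj_matrix_symmetric[OF G],
        where a = "\<lambda>c i. incidence_sign f c i - incidence_sign f 0 i"])
    fix x :: "nat \<Rightarrow> real"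
    assume x: "\<forall>c\<in>{1..<k}. (\<Sum>i<n. (incidence_sign f c i - incidence_sign f 0 i) * x i) = 0"
      and nz: "\<exists>i<n. x i \<noteq> 0"
    define t where "t = (\<Sum>i<n. incidence_sign f 0 i * x i)"
    define Y where "Y = (\<Sum>i<n. of_bool (card (f i) = 2) * x i)"
    define Z where "Z = (\<Sum>i<n. of_bool (card (f i) = 1) * x i)"
    define N where "N = (\<Sum>i<n. of_bool (card (f i) = 2) * (x i)\<^sup>2)"
    have t: "(\<Sum>i<n. incidence_sign f c i * x i) = t" if "c < k" for c
      using x that by (cases "c = 0") (auto simp: t_def left_diff_distrib sum_subtractf)
    \<comment> \<open>Double counting: each pair enters two of the \<open>t c\<close> with sign 1,
      each singleton one of them with sign -1.\<close>
    have "k * t = (\<Sum>c<k. \<Sum>i<n. incidence_sign f c i * x i)" by (simp add: t)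
    also have "\<dots> = (\<Sum>i<n. \<Sum>c<k. incidence_sign f c i * x i)" by (rule sum.swap)
    also have "\<dots> = (\<Sum>i<n. 2 * (of_bool (card (f i) = 2) * x i) - of_bool (card (f i) = 1) * x i)"
    proof (intro sum.cong refl)
      fix i assume "i \<in> {..<n}"
      then have i: "i < n" by simp
      have "(\<Sum>c<k. incidence_sign f c i) = (\<Sum>c\<in>{..<k} \<inter> f i. if card (f i) = 1 then - 1 else 1)"
        unfolding incidence_sign_def by (simp only: sum.inter_restrict[OF finite_lessThan])
      also have "{..<k} \<inter> f i = f i" using f(1)[OF i] by auto
      finally have "(\<Sum>c<k. incidence_sign f c i) = 2 * of_bool (card (f i) = 2) - of_bool (card (f i) = 1)"
        using f(2)[OF i] by auto
      then show "(\<Sum>c<k. incidence_sign f c i * x i)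
          = 2 * (of_bool (card (f i) = 2) * x i) - of_bool (card (f i) = 1) * x i"
        unfolding sum_distrib_right[symmetric] by (simp only: left_diff_distrib mult.assoc)
    qed
    also have "\<dots> = 2 * Y - Z" by (simp only: sum_subtractf sum_distrib_left Y_def Z_def)
    finally have kt: "k * t = 2 * Y - Z" .
    have form: "(\<Sum>i<n. \<Sum>j<n. adj_matrix n (singleton_pair_adj f) $$ (i,j) * x i * x j)
        = Y\<^sup>2 + Z\<^sup>2 + N - k * t\<^sup>2"
    proof -
      have "(\<Sum>c<k. (\<Sum>i<n. incidence_sign f c i * x i)\<^sup>2) = k * t\<^sup>2" by (simp add: t)
      then show ?thesis
        using singleton_pair_adj_form[OF f inj, of x] unfolding Y_def Z_def N_def by (simp only:)
    qed
    have "N \<ge> 0" unfolding N_def by (intro sum_nonneg) auto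
    \<comment> \<open>Cauchy-Schwarz for \<open>(2, -1)\<close> and \<open>(Y, Z)\<close>; this is where \<open>k \<ge> 5\<close> is needed.\<close>
    have cs: "k * t\<^sup>2 \<le> Y\<^sup>2 + Z\<^sup>2"
    proof -
      have "k * (k * t\<^sup>2) = (2 * Y - Z)\<^sup>2" unfolding kt[symmetric] by (simp add: power2_eq_square)
      also have "\<dots> \<le> (2 * Y - Z)\<^sup>2 + (Y + 2 * Z)\<^sup>2" by simp
      also have "\<dots> = 5 * (Y\<^sup>2 + Z\<^sup>2)" by (simp add: power2_eq_square algebra_simps)
      also have "\<dots> \<le> k * (Y\<^sup>2 + Z\<^sup>2)" using k by (intro mult_right_mono) auto
      finally show ?thesis using k by simp
    qed
    show "(\<Sum>i<n. \<Sum>j<n. adj_matrix n (singleton_pair_adj f) $$ (i,j) * x i * x j) > 0"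
    \<comment> \<open>If the form is not positive, then \<open>N = 0\<close>, so all pair weights
      and \<open>Y\<close> vanish and \<open>Z = - (k * t)\<close>. The inequality becomes
      \<open>k^2 t^2 \<le> k t^2\<close>, which forces \<open>t = 0\<close>; the singleton weights
      follow.\<close>
    proof (rule ccontr)
      assume "\<not> ?thesis"
      then have "N = 0" and eq: "Y\<^sup>2 + Z\<^sup>2 \<le> k * t\<^sup>2" using cs \<open>N \<ge> 0\<close> unfolding form by linarith+
      then have "\<forall>i<n. of_bool (card (f i) = 2) * (x i)\<^sup>2 = 0"
        unfolding N_def by (subst (asm) sum_nonneg_eq_0_iff) auto
      then have x2: "x i = 0" if "i < n" "card (f i) = 2" for i using that by auto
      have "Y = 0" unfolding Y_def by (intro sum.neutral) (auto simp: x2)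
      have "t = 0"
      proof (rule ccontr)
        assume "t \<noteq> 0"
        have "Z = - (k * t)" using kt \<open>Y = 0\<close> by simp
        then have "(real k * k) * t\<^sup>2 \<le> k * t\<^sup>2"
          using eq \<open>Y = 0\<close> by (simp add: power2_eq_square mult_ac)
        then show False using k \<open>t \<noteq> 0\<close> by simp
      qed
      have "x i = 0" if i: "i < n" for i
      proof (cases "card (f i) = 2")
        case False
        then obtain c where c: "f i = {c}" using f(2)[OF i] card_1_singletonE by metis
        then have "c < k" using f(1)[OF i] by auto
        \<comment> \<open>Pairs have weight 0 and the other singletons miss \<open>c\<close>, so
          only \<open>i\<close> contributes, and \<open>t c\<close> is the negated weight of
          \<open>{c}\<close>.\<close>
        have "(\<Sum>j<n. incidence_sign f c j * x j) = (\<Sum>j<n. if j = i then - x i else 0)"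
        proof (intro sum.cong refl)
          fix j assume "j \<in> {..<n}"
          then have j: "j < n" by simp
          show "incidence_sign f c j * x j = (if j = i then - x i else 0)"
          proof (cases "card (f j) = 2")
            case True
            then show ?thesis using x2[OF j] c by (auto simp: incidence_sign_def)
          next
            case False
            then obtain e where e: "f j = {e}" using f(2)[OF j] card_1_singletonE by metis
            then show ?thesis using c inj_onD[OF inj, of j i] i j by (auto simp: incidence_sign_def)
          qed
        qed
        then show ?thesis using t[OF \<open>c < k\<close>] \<open>t = 0\<close> i by simp
      qed (use x2 i in blast)
      then show False using nz by blast
    qed
  qed auto
  then show ?thesis by simp
qed

lemma card_singletons_pairs:
  "card {s. s \<subseteq> {..<k} \<and> (card s = 1 \<or> card s = 2)} = k * (k + 1) div 2"
proof -
  have "{s. s \<subseteq> {..<k} \<and> (card s = 1 \<or> card s = 2)}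
      = {s. s \<subseteq> {..<k} \<and> card s = 1} \<union> {s. s \<subseteq> {..<k} \<and> card s = 2}" by auto
  also have "card \<dots> = card {s. s \<subseteq> {..<k} \<and> card s = 1} + card {s. s \<subseteq> {..<k} \<and> card s = 2}"
    by (rule card_Un_disjoint) auto
  also have "\<dots> = k + (k choose 2)" by (simp add: n_subsets)
  also have "\<dots> = k * (k + 1) div 2"
    by (cases k) (auto simp: choose_two algebra_simps)
  finally show ?thesis .
qed

theorem mainTheorem12:
  fixes k :: nat
  assumes "k \<ge> 5"
  shows "ramsey_num k (k + 1) \<ge> NPO k \<and> NPO k > k * (k + 1) div 2"
proof
  show "NPO k \<le> ramsey_num k (k + 1)"
    unfolding NPO_def using num_nonpos_eigs_ge_if_ramsey_num_le by (intro Least_le) blast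
  let ?V = "{s. s \<subseteq> {..<k} \<and> (card s = 1 \<or> card s = 2)}"
  let ?n = "k * (k + 1) div 2"
  have "finite ?V" by (rule finite_subset[of _ "Pow {..<k}"]) auto
  then obtain f where f: "bij_betw f {..<?n} ?V"
    using ex_bij_betw_nat_finite[of ?V] unfolding card_singletons_pairs atLeast0LessThan by blast
  have fV: "f i \<in> ?V" if "i < ?n" for i using bij_betwE[OF f] that by blast
  have "num_nonpos_eigs (adj_matrix ?n (singleton_pair_adj f)) \<le> k - 1"
    using fV bij_betw_imp_inj_on[OF f] by (intro num_nonpos_eigs_singleton_pair_adj_le[OF assms]) auto
  moreover have "is_graph ?n (singleton_pair_adj f)"
    using fV by (intro is_graph_singleton_pair_adj) fastforce
  \<comment> \<open>If \<open>NPO k\<close> were at most \<open>?n\<close>, this graph would have at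
    least \<open>k\<close> nonpositive eigenvalues, but it has at most \<open>k - 1\<close>.\<close>
  ultimately show "NPO k > ?n" using NPO_property[of ?n "singleton_pair_adj f" k] assms by fastforce
qed

end
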